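(* Apart from applying the commutation relations, the reduced form $P_n^{\mathcal{B}}$ of $$w_{D_n}=x_{12}x_{23}\cdots x_{n-1,n}\,y_{n-1,n}$$ in the $\beta$-bracket algebra of type $D_n$ does not depend on the order in which the reductions are performed; i.e. any two reduced forms of $w_{D_n}$ are equal modulo the commutation relations.
   Context: Work with noncommutative polynomials over $\mathbb{Q}[\beta]$ ($\beta$ a central variable) in $x_{ij},y_{ij}$, $1\le i<j\le n$, modulo the commutation relations $x_{ij}x_{kl}=x_{kl}x_{ij}$, $y_{ij}x_{kl}=x_{kl}y_{ij}$, $y_{ij}y_{kl}=y_{kl}y_{ij}$ for $i<j$, $k<l$ with $i,j,k,l$ distinct. (In the algebra one also has $x_{ji}=-x_{ij}$, $y_{ji}=y_{ij}$, so only variables with $i<j$ are needed.) Reduction rules, for $1\le i<j<k\le n$, each applied to two adjacent letters of a monomial, possibly after commutations: (5) $x_{ij}x_{jk}\to x_{ik}x_{ij}+x_{jk}x_{ik}+\beta x_{ik}$; (5') $x_{jk}x_{ij}\to x_{ij}x_{ik}+x_{ik}x_{jk}+\beta x_{ik}$; (6) $x_{ij}y_{jk}\to y_{ik}x_{ij}+y_{jk}y_{ik}+\beta y_{ik}$; (6') $y_{jk}x_{ij}\to x_{ij}y_{ik}+y_{ik}y_{jk}+\beta y_{ik}$; (7) $x_{ik}y_{jk}\to y_{jk}y_{ij}+y_{ij}x_{ik}+\beta y_{ij}$; (7') $y_{jk}x_{ik}\to y_{ij}y_{jk}+x_{ik}y_{ij}+\beta y_{ij}$; (8) $y_{ik}x_{jk}\to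 x_{jk}y_{ij}+y_{ij}y_{ik}+\beta y_{ij}$; (8') $x_{jk}y_{ik}\to y_{ij}x_{jk}+y_{ik}y_{ij}+\beta y_{ij}$. A reduced form of a monomial is a polynomial obtained from it by successively applying these rules to monomials of the current polynomial, in any order, until no rule can be applied (even after commutations). *)

theory Defs
  imports
    "HOL-Library.Poly_Mapping"
    "HOL-Computational_Algebra.Polynomial"
begin

text \<open>
  Words form the free monoid, written additively because the convolution product of
  \<^type>\<open>poly_mapping\<close> multiplies the monomials with indices \<open>s\<close> and \<open>t\<close> to the monomial
  with index \<open>s + t\<close>.
\<close>

datatype 'a nc_word = Word "'a list"

instantiation nc_word :: (type) monoid_add
begin

definition zero_nc_word :: "'a nc_word"
  where "0 = Word []"

fun plus_nc_word :: "'a nc_word \<Rightarrow> 'a nc_word \<Rightarrow> 'a nc_word"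
  where "Word u + Word v = Word (u @ v)"

instance
proof
  fix a b c :: "'a nc_word"
  show "a + b + c = a + (b + c)" by (cases a; cases b; cases c) simp
  show "0 + a = a" by (cases a) (simp add: zero_nc_word_def)
  show "a + 0 = a" by (cases a) (simp add: zero_nc_word_def)
qed

end

text \<open>\<open>X i j\<close> and \<open>Y i j\<close> stand for \<open>x\<^sub>i\<^sub>j\<close> and \<open>y\<^sub>i\<^sub>j\<close>; only those in \<open>letters n\<close> are used.\<close>

datatype letter = X nat nat | Y nat nat

fun indices :: "letter \<Rightarrow> nat set" where
  "indices (X i j) = {i, j}"
| "indices (Y i j) = {i, j}"

definition letters :: "nat \<Rightarrow> letter set" where
  "letters n = {X i j | i j. 1 \<le> i \<and> i < j \<and> j \<le> n} \<union> {Y i j | i j. 1 \<le> i \<and> i < j \<and> j \<le> n}"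

text \<open>The free algebra over \<open>\<rat>[\<beta>]\<close>; the variable of \<^typ>\<open>rat poly\<close> is \<open>\<beta>\<close>.\<close>

type_synonym ncpoly = "letter nc_word \<Rightarrow>\<^sub>0 rat poly"

definition scalar :: "rat poly \<Rightarrow> ncpoly" where
  "scalar c = Poly_Mapping.single 0 c"

definition beta :: ncpoly where
  "beta = scalar [:0, 1:]"

definition mon :: "letter list \<Rightarrow> ncpoly" where
  "mon w = Poly_Mapping.single (Word w) 1"

definition coeff_of :: "ncpoly \<Rightarrow> letter list \<Rightarrow> rat poly" where
  "coeff_of p w = Poly_Mapping.lookup p (Word w)"

abbreviation xx :: "nat \<Rightarrow> nat \<Rightarrow> ncpoly" where
  "xx i j \<equiv> mon [X i j]"

abbreviation yy :: "nat \<Rightarrow> nat \<Rightarrow> ncpoly" where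
  "yy i j \<equiv> mon [Y i j]"

definition commuting :: "nat \<Rightarrow> letter \<Rightarrow> letter \<Rightarrow> bool" where
  "commuting n a b \<longleftrightarrow> a \<in> letters n \<and> b \<in> letters n \<and> indices a \<inter> indices b = {}"

inductive swap :: "nat \<Rightarrow> letter list \<Rightarrow> letter list \<Rightarrow> bool" for n where
  "commuting n a b \<Longrightarrow> swap n (u @ [a, b] @ v) (u @ [b, a] @ v)"

text \<open>The two-sided ideal of the free algebra generated by the commutation relations.\<close>

inductive_set comm_ideal :: "nat \<Rightarrow> ncpoly set" for n where
  zero: "0 \<in> comm_ideal n"
| gen: "commuting n a b \<Longrightarrow> f * (mon [a, b] - mon [b, a]) * g \<in> comm_ideal n"
| add: "f \<in> comm_ideal n \<Longrightarrow> g \<in> comm_ideal n \<Longrightarrow> f + g \<in> comm_ideal n"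

definition eq_mod_comm :: "nat \<Rightarrow> ncpoly \<Rightarrow> ncpoly \<Rightarrow> bool" where
  "eq_mod_comm n p q \<longleftrightarrow> p - q \<in> comm_ideal n"

inductive rule :: "nat \<Rightarrow> letter list \<Rightarrow> ncpoly \<Rightarrow> bool" for n where
  r5:  "1 \<le> i \<Longrightarrow> i < j \<Longrightarrow> j < k \<Longrightarrow> k \<le> n \<Longrightarrow>
    rule n [X i j, X j k] (xx i k * xx i j + xx j k * xx i k + beta * xx i k)"
| r5': "1 \<le> i \<Longrightarrow> i < j \<Longrightarrow> j < k \<Longrightarrow> k \<le> n \<Longrightarrow>
    rule n [X j k, X i j] (xx i j * xx i k + xx i k * xx j k + beta * xx i k)"
| r6:  "1 \<le> i \<Longrightarrow> i < j \<Longrightarrow> j < k \<Longrightarrow> k \<le> n \<Longrightarrow>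
    rule n [X i j, Y j k] (yy i k * xx i j + yy j k * yy i k + beta * yy i k)"
| r6': "1 \<le> i \<Longrightarrow> i < j \<Longrightarrow> j < k \<Longrightarrow> k \<le> n \<Longrightarrow>
    rule n [Y j k, X i j] (xx i j * yy i k + yy i k * yy j k + beta * yy i k)"
| r7:  "1 \<le> i \<Longrightarrow> i < j \<Longrightarrow> j < k \<Longrightarrow> k \<le> n \<Longrightarrow>
    rule n [X i k, Y j k] (yy j k * yy i j + yy i j * xx i k + beta * yy i j)"
| r7': "1 \<le> i \<Longrightarrow> i < j \<Longrightarrow> j < k \<Longrightarrow> k \<le> n \<Longrightarrow>
    rule n [Y j k, X i k] (yy i j * yy j k + xx i k * yy i j + beta * yy i j)"
| r8:  "1 \<le> i \<Longrightarrow> i < j \<Longrightarrow> j < k \<Longrightarrow> k \<le> n \<Longrightarrow>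
    rule n [Y i k, X j k] (xx j k * yy i j + yy i j * yy i k + beta * yy i j)"
| r8': "1 \<le> i \<Longrightarrow> i < j \<Longrightarrow> j < k \<Longrightarrow> k \<le> n \<Longrightarrow>
    rule n [X j k, Y i k] (yy i j * xx j k + yy i k * yy i j + beta * yy i j)"

text \<open>
  Both kinds of step act on the whole term \<open>c w\<close> of a word \<open>w\<close> that occurs in the polynomial with
  coefficient \<open>c \<noteq> 0\<close>. Commutations are applied to single terms, not to the polynomial as a
  whole: otherwise \<open>0\<close> could be rewritten to \<open>w - w'\<close> with \<open>w\<close>, \<open>w'\<close> equal up to
  commutations, and the two terms reduced differently.
\<close>

inductive step :: "nat \<Rightarrow> ncpoly \<Rightarrow> ncpoly \<Rightarrow> bool" for n where
  commute: "coeff_of p w = c \<Longrightarrow> c \<noteq> 0 \<Longrightarrow> swap n w w' \<Longrightarrow>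
    step n p (p - scalar c * mon w + scalar c * mon w')"
| reduce: "coeff_of p (u @ l @ v) = c \<Longrightarrow> c \<noteq> 0 \<Longrightarrow> rule n l r \<Longrightarrow>
    step n p (p - scalar c * mon (u @ l @ v) + scalar c * (mon u * r * mon v))"

definition irreducible_poly :: "nat \<Rightarrow> ncpoly \<Rightarrow> bool" where
  "irreducible_poly n p \<longleftrightarrow>
     (\<forall>w w'. coeff_of p w \<noteq> 0 \<longrightarrow> (swap n)\<^sup>*\<^sup>* w w' \<longrightarrow> \<not> (\<exists>u l v r. w' = u @ l @ v \<and> rule n l r))"

definition reduced_form :: "nat \<Rightarrow> letter list \<Rightarrow> ncpoly \<Rightarrow> bool" where
  "reduced_form n w p \<longleftrightarrow> (step n)\<^sup>*\<^sup>* (mon w) p \<and> irreducible_poly n p"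

definition w_D :: "nat \<Rightarrow> letter list" where
  "w_D n = map (\<lambda>i. X i (i + 1)) [1..<n] @ [Y (n - 1) n]"

end

theory Submission
  imports Defs
begin

text \<open>
  Read \<open>x\<^sub>i\<^sub>j\<close> and \<open>y\<^sub>i\<^sub>j\<close> as the roots \<open>e\<^sub>i - e\<^sub>j\<close> and \<open>e\<^sub>i + e\<^sub>j\<close>. Every rule then has the form
  \<open>a b \<rightarrow> c a + b c + \<beta> c\<close> with \<open>c = a + b\<close>, which is the decomposition of the open cone spanned by
  \<open>a, b\<close> into the open cones spanned by \<open>c, a\<close>, by \<open>b, c\<close> and by \<open>c\<close>. Hence, for every vector \<open>p\<close>, giving a
  word \<open>w\<close> the value \<open>\<beta>\<close> to the length of \<open>w\<close> times the number of ways to write \<open>p\<close> as a combination of the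
  letters of \<open>w\<close> with positive integer coefficients defines a linear functional that is constant
  along reductions.

  All words that arise from \<open>w\<^sub>D\<close> satisfy a condition on pairs of letters (\<open>may_precede\<close>) that is
  stable under the rules. In an irreducible such word no two letters sum to a root and no two cross.
  A vector is a positive combination of at most one such set, and that set determines
  the word up to commutations. The functionals therefore separate the irreducible words up to
  commutations, and two reduced forms agree because they have the same values.
\<close>

section \<open>Roots, the precedence condition and its stability under the rules\<close>

fun root_vec :: "letter \<Rightarrow> nat \<Rightarrow> int" where
  "root_vec (X i j) k = of_bool (k = i) - of_bool (k = j)"
| "root_vec (Y i j) k = of_bool (k = i) + of_bool (k = j)"

text \<open>
  Found by enumerating the words reachable from \<open>w\<^sub>D\<close> for small \<open>n\<close>. The index \<open>n\<close> is special: it is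
  the only sink \<open>j\<close> for which \<open>X i j\<close> may occur together with some \<open>Y i j\<close>.
\<close>

fun may_precede :: "nat \<Rightarrow> letter \<Rightarrow> letter \<Rightarrow> bool" where
  "may_precede n (X i j) (X k l) = (j \<le> k \<or> l < i \<or> (i \<le> k \<and> l < j) \<or> (k < i \<and> j \<le> l))"
| "may_precede n (X i j) (Y k l) =
    (if j < n then j \<le> k \<or> (k < i \<and> j \<le> l) \<or> l < i
     else if l < n then k < i \<and> i \<le> l else i \<le> k)"
| "may_precede n (Y k l) (X i j) =
    (if j < n then l \<le> i \<or> (k \<le> i \<and> j < l) \<or> j < k else l < n \<and> k \<le> i \<and> i < l)"
| "may_precede n (Y i j) (Y k l) =
    (if j < n then if l < n then (i \<le> k \<and> l < j) \<or> (k < i \<and> j \<le> l) else i \<le> k \<and> k < j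
     else if l < n then k < i \<and> i \<le> l else k < i)"

text \<open>The pairs whose sum is a root, that is, those to which a rule applies in either order.\<close>

fun opposed :: "letter \<Rightarrow> letter \<Rightarrow> bool" where
  "opposed (X i j) (X k l) = (j = k \<or> l = i)"
| "opposed (X i j) (Y k l) = (j = k \<or> (j = l \<and> i \<noteq> k))"
| "opposed (Y k l) (X i j) = (j = k \<or> (j = l \<and> i \<noteq> k))"
| "opposed (Y i j) (Y k l) = False"

definition good :: "nat \<Rightarrow> letter list \<Rightarrow> bool" where
  "good n w \<longleftrightarrow> set w \<subseteq> letters n \<and> sorted_wrt (may_precede n) w"

lemma X_in_letters [simp]: "X i j \<in> letters n \<longleftrightarrow> 1 \<le> i \<and> i < j \<and> j \<le> n"
  and Y_in_letters [simp]: "Y i j \<in> letters n \<longleftrightarrow> 1 \<le> i \<and> i < j \<and> j \<le> n"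
  by (auto simp: letters_def)

lemma finite_letters [simp]: "finite (letters n)"
proof -
  have "letters n \<subseteq> (\<lambda>(i, j). X i j) ` ({..n} \<times> {..n}) \<union> (\<lambda>(i, j). Y i j) ` ({..n} \<times> {..n})"
    by (force simp: letters_def)
  then show ?thesis by (rule finite_subset) auto
qed

lemma may_precede_irrefl: "a \<in> letters n \<Longrightarrow> \<not> may_precede n a a"
  by (cases a) auto

lemma may_precede_commute: "commuting n a b \<Longrightarrow> may_precede n a b \<Longrightarrow> may_precede n b a"
  by (cases a; cases b) (auto simp: commuting_def split: if_splits)

text \<open>Makes the order of two noncommuting letters in a good word depend on the pair alone;
  \<open>good_same_set\<close> rests on this.\<close>

lemma may_precede_antisym:
  "a \<in> letters n \<Longrightarrow> b \<in> letters n \<Longrightarrow> may_precede n a b \<Longrightarrow> may_precede n b a \<Longrightarrow> commuting n a b"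
  by (cases a; cases b) (auto simp: commuting_def split: if_splits)

text \<open>What keeps a word good when \<open>a b\<close> is replaced by \<open>c a\<close>,
  \<open>b c\<close> or \<open>c\<close>; the letters \<open>d\<close> stand for the context on
  either side.\<close>

definition sum_closed :: "nat \<Rightarrow> letter \<Rightarrow> letter \<Rightarrow> letter \<Rightarrow> bool" where
  "sum_closed n a b c \<longleftrightarrow> (may_precede n a b \<longrightarrow> may_precede n c a \<and> may_precede n b c \<and>
      (\<forall>d \<in> letters n. (may_precede n d a \<and> may_precede n d b \<longrightarrow> may_precede n d c) \<and> (may_precede n a d \<and> may_precede n b d \<longrightarrow> may_precede n c d)))"

lemma ball_letters: "(\<forall>d \<in> letters n. P d) \<longleftrightarrow>
    (\<forall>i j. 1 \<le> i \<and> i < j \<and> j \<le> n \<longrightarrow> P (X i j) \<and> P (Y i j))"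
  by (auto simp: letters_def)

lemma sum_closed_triple:
  assumes "1 \<le> i" "i < j" "j < k" "k \<le> n"
  shows "sum_closed n (X i j) (X j k) (X i k)"
    "sum_closed n (X j k) (X i j) (X i k)"
    "sum_closed n (X i j) (Y j k) (Y i k)"
    "sum_closed n (Y j k) (X i j) (Y i k)"
    "sum_closed n (X i k) (Y j k) (Y i j)"
    "sum_closed n (Y j k) (X i k) (Y i j)"
    "sum_closed n (Y i k) (X j k) (Y i j)"
    "sum_closed n (X j k) (Y i k) (Y i j)"
  unfolding sum_closed_def ball_letters using assms by (auto split: if_splits)

text \<open>Gathers the common form of the eight rules, so that the invariance proof treats them at
  once. Some rules list \<open>b c\<close> before \<open>c a\<close>; \<open>algebra_simps\<close>
  also reconciles that order.\<close>

lemma rule_shape: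
  assumes "rule n l r"
  shows "\<exists>a b c. l = [a, b] \<and> {a, b, c} \<subseteq> letters n \<and> r = mon [c, a] + mon [b, c] + beta * mon [c] \<and>
    (\<forall>k. root_vec c k = root_vec a k + root_vec b k) \<and> sum_closed n a b c"
proof -
  have *: "mon [a] * mon [b] = mon [a, b]" for a b
    by (simp add: mon_def mult_single)
  show ?thesis
    using assms
  proof cases
    case (r5 i j k) then show ?thesis
      by (intro exI[of _ "X i j"] exI[of _ "X j k"] exI[of _ "X i k"]) (simp add: * algebra_simps sum_closed_triple)
    next case (r5' i j k) then show ?thesis
      by (intro exI[of _ "X j k"] exI[of _ "X i j"] exI[of _ "X i k"]) (simp add: * algebra_simps sum_closed_triple)
    next case (r6 i j k) then show ?thesis
      by (intro exI[of _ "X i j"] exI[of _ "Y j k"] exI[of _ "Y i k"]) (simp add: * algebra_simps sum_closed_triple)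
    next case (r6' i j k) then show ?thesis
      by (intro exI[of _ "Y j k"] exI[of _ "X i j"] exI[of _ "Y i k"]) (simp add: * algebra_simps sum_closed_triple)
    next case (r7 i j k) then show ?thesis
      by (intro exI[of _ "X i k"] exI[of _ "Y j k"] exI[of _ "Y i j"]) (simp add: * algebra_simps sum_closed_triple)
    next case (r7' i j k) then show ?thesis
      by (intro exI[of _ "Y j k"] exI[of _ "X i k"] exI[of _ "Y i j"]) (simp add: * algebra_simps sum_closed_triple)
    next case (r8 i j k) then show ?thesis
      by (intro exI[of _ "Y i k"] exI[of _ "X j k"] exI[of _ "Y i j"]) (simp add: * algebra_simps sum_closed_triple)
    next case (r8' i j k) then show ?thesis
      by (intro exI[of _ "X j k"] exI[of _ "Y i k"] exI[of _ "Y i j"]) (simp add: * algebra_simps sum_closed_triple)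
  qed
qed

lemma opposed_rule:
  assumes "a \<in> letters n" "b \<in> letters n" "opposed a b"
  shows "\<exists>r. rule n [a, b] r"
proof (cases a; cases b)
  fix i j k l
  assume "a = X i j" "b = X k l"
  then show ?thesis
    using assms rule.r5[of i j l n] rule.r5'[of k l j n] by auto
next
  fix i j k l
  assume "a = X i j" "b = Y k l"
  then show ?thesis
    \<comment> \<open>If the two letters share their larger index, the order of \<open>i\<close> and
      \<open>k\<close> selects \<open>r7\<close> or \<open>r8'\<close>.\<close>
    using assms rule.r6[of i j l n] rule.r7[of i k l n] rule.r8'[of k i l n]
    by (cases i k rule: linorder_cases) auto
next
  fix i j k l
  assume "b = X i j" "a = Y k l"
  then show ?thesis
    using assms rule.r6'[of i j l n] rule.r7'[of i k l n] rule.r8[of k i l n]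
    by (cases i k rule: linorder_cases) auto
qed (use assms in auto)

subsection \<open>Words up to commutations\<close>

lemma swap_rtranclp_sym: "(swap n)\<^sup>*\<^sup>* w w' \<Longrightarrow> (swap n)\<^sup>*\<^sup>* w' w"
proof (induction rule: rtranclp_induct)
  case (step y z)
  from step.hyps(2) have "swap n z y"
    by cases (auto intro!: swap.intros simp: commuting_def Int_commute simp del: append_Cons)
  then show ?case using step.IH by (rule converse_rtranclp_into_rtranclp)
qed simp

lemma swap_context:
  assumes "swap n w w'"
  shows "swap n (u @ w @ v) (u @ w' @ v)"
  using assms
proof cases
  case (1 a b u' v')
  then show ?thesis
    using swap.intros[of n a b "u @ u'" "v' @ v"] by simp
qed

lemma swap_rtranclp_context:
  "(swap n)\<^sup>*\<^sup>* w w' \<Longrightarrow> (swap n)\<^sup>*\<^sup>* (u @ w @ v) (u @ w' @ v)"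
  by (induction rule: rtranclp_induct) (blast intro: rtranclp.rtrancl_into_rtrancl swap_context)+

lemma swap_move_front:
  "(\<And>e. e \<in> set m \<Longrightarrow> commuting n e f) \<Longrightarrow> (swap n)\<^sup>*\<^sup>* (u @ m @ f # v) (u @ f # m @ v)"
proof (induction m arbitrary: u)
  case (Cons e m)
  have "(swap n)\<^sup>*\<^sup>* ((u @ [e]) @ m @ f # v) ((u @ [e]) @ f # m @ v)"
    by (rule Cons.IH) (use Cons.prems in auto)
  moreover have "swap n (u @ [e, f] @ (m @ v)) (u @ [f, e] @ (m @ v))"
    by (rule swap.intros) (use Cons.prems in auto)
  ultimately show ?case by simp
qed simp

lemma good_swap: "swap n w w' \<Longrightarrow> good n w \<Longrightarrow> good n w'"
  by (erule swap.cases) (auto simp: good_def sorted_wrt_append dest: may_precede_commute)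

lemma good_swap_rtranclp: "(swap n)\<^sup>*\<^sup>* w w' \<Longrightarrow> good n w \<Longrightarrow> good n w'"
  by (induction rule: rtranclp_induct) (auto intro: good_swap)

lemma good_distinct: "good n w \<Longrightarrow> distinct w"
  by (induction w) (auto simp: good_def dest: may_precede_irrefl)

text \<open>The first letter \<open>a\<close> of \<open>w\<close> precedes all others there, so
  every letter before \<open>a\<close> in \<open>w'\<close> commutes with it by
  \<open>may_precede_antisym\<close>, and \<open>a\<close> can be moved to the front of
  \<open>w'\<close>.\<close>

lemma good_same_set:
  "good n w \<Longrightarrow> good n w' \<Longrightarrow> set w = set w' \<Longrightarrow> (swap n)\<^sup>*\<^sup>* w w'"
proof (induction w arbitrary: w')
  case (Cons a t)
  then have "a \<in> set w'" by auto
  then obtain u v where w': "w' = u @ a # v" by (auto dest: split_list)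
  have d: "distinct (a # t)" "distinct (u @ a # v)"
    using Cons.prems w' good_distinct by blast+
  have st: "set t = set u \<union> set v"
    using Cons.prems(3) d w' by auto
  have "commuting n e a" if "e \<in> set u" for e
  proof -
    have "may_precede n e a" using Cons.prems(2) that by (auto simp: w' good_def sorted_wrt_append)
    moreover have "may_precede n a e" using Cons.prems(1) that st by (auto simp: good_def)
    moreover have "{a, e} \<subseteq> letters n" using Cons.prems(2) that by (auto simp: w' good_def)
    ultimately show ?thesis by (auto intro: may_precede_antisym)
  qed
  then have 1: "(swap n)\<^sup>*\<^sup>* ([] @ u @ a # v) ([] @ a # u @ v)"
    by (rule swap_move_front)
  have "good n t" "good n (u @ v)"
    using Cons.prems(1,2) by (auto simp: w' good_def sorted_wrt_append)
  then have "(swap n)\<^sup>*\<^sup>* t (u @ v)"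
    using Cons.IH st by auto
  from swap_rtranclp_context[OF this, of "[a]" "[]"] swap_rtranclp_sym[OF 1]
  show ?case by (simp add: w')
qed simp

section \<open>Opposed letters in irreducible good words\<close>

text \<open>
  Contains all letters that can end a chain of consecutively noncommuting, unopposed letters
  starting in \<open>a\<close>, but no letter opposed to \<open>a\<close>. Hence nothing can keep two opposed letters apart.
\<close>

fun reach :: "nat \<Rightarrow> letter \<Rightarrow> letter \<Rightarrow> bool" where
  "reach n (X i j) (X k l) = (if j < n then l \<le> j else l < n \<or> k \<le> i)"
| "reach n (X i j) (Y k l) = (\<not> j < n \<and> k \<le> i)"
| "reach n (Y i j) e = True"

lemma reach_refl: "a \<in> letters n \<Longrightarrow> reach n a a"
  by (cases a) auto

lemma reach_step:
  assumes "{a, e, f} \<subseteq> letters n" "reach n a e" "may_precede n e f" "\<not> opposed e f" "\<not> commuting n e f"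
  shows "reach n a f"
  using assms by (cases a; cases e; cases f) (auto simp: commuting_def split: if_splits)

lemma not_reach_opposed:
  assumes "{a, b} \<subseteq> letters n" "may_precede n a b" "opposed a b"
  shows "\<not> reach n a b"
  using assms by (cases a; cases b) (auto split: if_splits)

text \<open>Induction on the number of letters in between: either there is a closer opposed pair, or
  commutations shorten the gap. The final pair \<open>c, d\<close> need not be
  \<open>a, b\<close>.\<close>

lemma opposed_become_adjacent:
  assumes "good n (p @ a # z @ b # q)" "opposed a b"
  shows "\<exists>u c d v. (swap n)\<^sup>*\<^sup>* (p @ a # z @ b # q) (u @ [c, d] @ v) \<and> opposed c d"
  using assms
proof (induction "length z" arbitrary: p a z b q rule: less_induct)
  case less
  let ?w = "p @ a # z @ b # q"
  have let_w: "set ?w \<subseteq> letters n" using less.prems(1) by (simp add: good_def)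
  \<comment> \<open>It is enough to reach, by commutations, a word with an opposed pair closer
    together.\<close>
  have via: ?case if "(swap n)\<^sup>*\<^sup>* ?w (p' @ a' # z' @ b' # q')" "length z' < length z" "opposed a' b'"
    for p' a' z' b' q'
    using less.hyps[OF that(2) good_swap_rtranclp[OF that(1) less.prems(1)] that(3)] that(1)
    by (meson rtranclp_trans)
  show ?case
  proof (cases "z = []")
    case True
    then show ?thesis using less.prems(2)
      by (intro exI[of _ p] exI[of _ a] exI[of _ b] exI[of _ q]) simp
  next
    case False
    show ?thesis
    proof (cases "\<exists>f \<in> set z. \<not> reach n a f")
      case True
      \<comment> \<open>The first letter outside \<open>reach\<close> of \<open>a\<close>. By
        \<open>reach_step\<close>, each letter of \<open>a # z1\<close> is opposed to
        \<open>f\<close> or commutes with it; if all commute, \<open>f\<close> moves in front of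
        \<open>a\<close>.\<close>
      then obtain z1 f z2 where z: "z = z1 @ f # z2" "\<not> reach n a f" "\<forall>e \<in> set z1. reach n a e"
        using split_list_first_prop[OF True] by auto
      show ?thesis
      proof (cases "\<exists>e \<in> set (a # z1). opposed e f")
        case True
        then consider "opposed a f" | e where "e \<in> set z1" "opposed e f" by auto
        then show ?thesis
        proof cases
          case 1
          then show ?thesis by (intro via[of p a z1 f "z2 @ b # q"]) (auto simp: z)
        next
          case 2
          then obtain y1 y2 where "z1 = y1 @ e # y2" by (auto dest: split_list)
          with 2 show ?thesis
            by (intro via[of "p @ a # y1" e y2 f "z2 @ b # q"]) (auto simp: z)
        qed
      next
        case no: False
        have "commuting n e f" if "e \<in> set (a # z1)" for e
        proof (rule ccontr)
          assume nc: "\<not> commuting n e f"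
          have "reach n a e" using that z let_w reach_refl by auto
          moreover have "may_precede n e f" using less.prems(1) that by (auto simp: z good_def sorted_wrt_append)
          moreover have "{a, e, f} \<subseteq> letters n" using let_w that by (auto simp: z)
          ultimately show False using reach_step[of a e f n] no nc that z(2) by auto
        qed
        then have "(swap n)\<^sup>*\<^sup>* (p @ (a # z1) @ f # (z2 @ b # q)) (p @ f # (a # z1) @ (z2 @ b # q))"
          by (rule swap_move_front)
        then show ?thesis
          using less.prems(2) by (intro via[of "p @ [f]" a "z1 @ z2" b q]) (auto simp: z)
      qed
    next
      case reach: False
      \<comment> \<open>All of \<open>z\<close> lies in \<open>reach\<close> of \<open>a\<close> but
        \<open>b\<close> does not, so the last letter \<open>e\<close> of \<open>z\<close> is
        opposed to \<open>b\<close> or commutes with it.\<close>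
      obtain z' e where z: "z = z' @ [e]" using False by (metis rev_exhaust)
      have "{a, e, b} \<subseteq> letters n" "may_precede n e b" "may_precede n a b" "reach n a e"
        using less.prems(1) reach by (auto simp: z good_def sorted_wrt_append)
      then have "opposed e b \<or> commuting n e b"
        using reach_step[of a e b n] not_reach_opposed[of a b n] less.prems(2) by auto
      then show ?thesis
      proof
        assume "opposed e b"
        then show ?thesis by (intro via[of "p @ a # z'" e "[]" b q]) (auto simp: z)
      next
        assume "commuting n e b"
        then have "swap n ((p @ a # z') @ [e, b] @ q) ((p @ a # z') @ [b, e] @ q)"
          by (rule swap.intros)
        then show ?thesis using less.prems(2)
          by (intro via[of p a z' b "e # q"]) (auto simp: z)
      qed
    qed
  qed
qed

definition compatible :: "nat \<Rightarrow> letter \<Rightarrow> letter \<Rightarrow> bool" where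
  "compatible n a b \<longleftrightarrow> (may_precede n a b \<or> may_precede n b a) \<and> \<not> opposed a b"

lemma opposed_sym: "opposed a b \<longleftrightarrow> opposed b a"
  by (cases a; cases b) auto

text \<open>If two letters were opposed, commutations would make some opposed pair adjacent and a
  rule would apply.\<close>

lemma irreducible_compatible:
  assumes "good n w" and irr: "\<And>w'. (swap n)\<^sup>*\<^sup>* w w' \<Longrightarrow> \<not> (\<exists>u l v r. w' = u @ l @ v \<and> rule n l r)"
  shows "pairwise (compatible n) (set w)"
proof -
  have "\<not> opposed (w ! i) (w ! j)" if "i < j" "j < length w" for i j
  proof
    assume opp: "opposed (w ! i) (w ! j)"
    let ?z = "take (j - Suc i) (drop (Suc i) w)"
    have "drop (Suc i) w = ?z @ w ! j # drop (Suc j) w"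
      using that id_take_nth_drop[of "j - Suc i" "drop (Suc i) w"] by simp
    then have w: "w = take i w @ w ! i # ?z @ w ! j # drop (Suc j) w"
      using that id_take_nth_drop[of i w] by simp
    from opposed_become_adjacent[of n "take i w" "w ! i" ?z "w ! j" "drop (Suc j) w"] opp \<open>good n w\<close>
    obtain u c d v where s: "(swap n)\<^sup>*\<^sup>* w (u @ [c, d] @ v)" "opposed c d"
      unfolding w[symmetric] by blast
    then have "good n (u @ [c, d] @ v)" using \<open>good n w\<close> good_swap_rtranclp by blast
    then have "c \<in> letters n" "d \<in> letters n" by (auto simp: good_def)
    with s opposed_rule irr show False by blast
  qed
  moreover have "may_precede n (w ! i) (w ! j)" if "i < j" "j < length w" for i j
    using that \<open>good n w\<close> by (auto simp: good_def sorted_wrt_iff_nth_less)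
  ultimately show ?thesis
    unfolding pairwise_def compatible_def
    by (metis in_set_conv_nth linorder_neqE_nat opposed_sym)
qed

subsection \<open>Uniqueness of compatible decompositions\<close>

text \<open>A decomposition of a vector is encoded by the multiplicities of all letters, so that
  equal decompositions are equal functions.\<close>

definition compatible_weight :: "nat \<Rightarrow> (letter \<Rightarrow> nat) \<Rightarrow> bool" where
  "compatible_weight n f \<longleftrightarrow> {a. 0 < f a} \<subseteq> letters n \<and> pairwise (compatible n) {a. 0 < f a}"

definition weight_vec :: "nat \<Rightarrow> (letter \<Rightarrow> nat) \<Rightarrow> nat \<Rightarrow> int" where
  "weight_vec n f k = (\<Sum>a \<in> letters n. int (f a) * root_vec a k)"

lemma compatible_weightD:
  assumes "compatible_weight n f" "0 < f a"
  shows "a \<in> letters n" and "0 < f b \<Longrightarrow> a \<noteq> b \<Longrightarrow> compatible n a b"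
  using assms by (auto simp: compatible_weight_def pairwise_def)

text \<open>Letters of opposite sign at \<open>i\<close> are opposed, except for a pair
  \<open>X h i\<close>, \<open>Y h i\<close>, which \<open>may_precede\<close> allows only for
  \<open>i = n\<close>. So nothing cancels below \<open>n\<close>, and the signs of a vector there
  reveal its letters.\<close>

lemma compatible_same_sign:
  assumes "compatible n a b" "{a, b} \<subseteq> letters n" "i < n" "root_vec a i > 0"
  shows "root_vec b i \<ge> 0"
  using assms
  by (cases a; cases b) (auto simp: compatible_def of_bool_def split: if_splits)

lemma weight_vec_pos:
  assumes f: "compatible_weight n f" "0 < f a" and i: "i < n" "root_vec a i > 0"
  shows "weight_vec n f i > 0"
  unfolding weight_vec_def
proof (rule sum_pos2)
  show "a \<in> letters n" using compatible_weightD[OF f] by simp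
  show "0 < int (f a) * root_vec a i" using f i by simp
  fix b assume "b \<in> letters n"
  then show "0 \<le> int (f b) * root_vec b i"
    using compatible_weightD[OF f] compatible_same_sign[of n a b i] i
    by (cases "f b = 0"; cases "a = b") auto
qed simp

lemma weight_vec_neg:
  assumes f: "compatible_weight n f" "0 < f a" and i: "i < n" "root_vec a i < 0"
  shows "weight_vec n f i < 0"
proof -
  have "0 < (\<Sum>b \<in> letters n. - (int (f b) * root_vec b i))"
  proof (rule sum_pos2)
    show "a \<in> letters n" using compatible_weightD[OF f] by simp
    show "0 < - (int (f a) * root_vec a i)" using f i by (simp add: mult_pos_neg)
    fix b assume b: "b \<in> letters n"
    show "0 \<le> - (int (f b) * root_vec b i)"
    proof (cases "f b = 0")
      case False
      \<comment> \<open>The same lemma with roles exchanged: \<open>b\<close> positive at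
        \<open>i\<close> would make \<open>a\<close> nonnegative there.\<close>
      have "root_vec b i \<le> 0"
        using compatible_weightD(2)[OF f(1), of b a] False f i b compatible_same_sign[of n b a i]
          compatible_weightD(1)[OF f]
        by (cases "a = b") fastforce+
      then show ?thesis by (simp add: mult_nonneg_nonpos)
    qed simp
  qed simp
  then show ?thesis by (simp add: weight_vec_def sum_negf)
qed

lemma weight_vec_posE:
  assumes "weight_vec n f i > 0"
  obtains (letter) a where "a \<in> letters n" "0 < f a" "root_vec a i > 0"
proof (rule ccontr)
  assume "\<not> thesis"
  then have "root_vec a i \<le> 0" if "a \<in> letters n" "0 < f a" for a
    using that(1,2) letter[of a] by linarith
  then have "int (f a) * root_vec a i \<le> 0" if "a \<in> letters n" for a
    using that by (cases "f a = 0") (simp_all add: mult_nonneg_nonpos)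
  then have "weight_vec n f i \<le> 0" unfolding weight_vec_def by (rule sum_nonpos)
  then show False using assms by simp
qed

lemma weight_vec_negE:
  assumes "weight_vec n f i < 0"
  obtains (letter) h where "X h i \<in> letters n" "0 < f (X h i)"
proof (rule ccontr)
  assume *: "\<not> thesis"
  have "int (f a) * root_vec a i \<ge> 0" if "a \<in> letters n" for a
  proof (cases "f a = 0")
    case False
    then show ?thesis using that * letter by (cases a) (auto simp: of_bool_def)
  qed simp
  then have "weight_vec n f i \<ge> 0" unfolding weight_vec_def by (rule sum_nonneg)
  then show False using assms by simp
qed

text \<open>
  Both \<open>i\<close> and \<open>j\<close> are determined by the vector: \<open>j\<close> is its first negative entry and \<open>i\<close> the last
  positive one before \<open>j\<close>. Any other letter at \<open>i\<close> would cross a letter \<open>X h j\<close> with \<open>h < i\<close>.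
\<close>

lemma sink_letter:
  assumes f: "compatible_weight n f" and j: "j < n" "weight_vec n f j < 0"
    and nonneg: "\<And>k. k < j \<Longrightarrow> weight_vec n f k \<ge> 0"
    and i: "i < j" "weight_vec n f i > 0"
    and max: "\<And>k. k < j \<Longrightarrow> weight_vec n f k > 0 \<Longrightarrow> k \<le> i"
  shows "0 < f (X i j)"
proof (rule ccontr)
  assume no: "\<not> ?thesis"
  obtain h where h: "X h j \<in> letters n" "0 < f (X h j)" using weight_vec_negE[OF j(2)] .
  have "weight_vec n f h > 0" using h j by (intro weight_vec_pos[OF f h(2)]) auto
  then have "h < i" using max[of h] h no by (cases "h = i") auto
  obtain e where e: "e \<in> letters n" "0 < f e" "root_vec e i > 0" using weight_vec_posE[OF i(2)] .
  have pos: "root_vec e k > 0 \<Longrightarrow> k < n \<Longrightarrow> weight_vec n f k > 0"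
    and neg: "root_vec e k < 0 \<Longrightarrow> k < n \<Longrightarrow> weight_vec n f k < 0" for k
    using weight_vec_pos[OF f e(2)] weight_vec_neg[OF f e(2)] by auto
  have "X h j \<noteq> e" using e \<open>h < i\<close> i by (auto simp: of_bool_def split: if_splits)
  then have c: "compatible n (X h j) e" using compatible_weightD(2)[OF f h(2) e(2)] by simp
  show False
  proof (cases e)
    case (X p q)
    \<comment> \<open>Here \<open>q < j\<close> would be a negative entry before \<open>j\<close>,
      \<open>q = j\<close> is excluded by \<open>no\<close>, and \<open>q > j\<close> crosses
      \<open>X h j\<close>.\<close>
    then have "p = i" using e by (auto simp: of_bool_def split: if_splits)
    then show False
      using X c e j i \<open>h < i\<close> no nonneg[of q] neg[of q]
      by (cases j q rule: linorder_cases) (auto simp: compatible_def)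
  next
    case (Y p q)
    then consider "p = i" | "q = i" using e by (auto simp: of_bool_def split: if_splits)
    then show False
    proof cases
      \<comment> \<open>Here \<open>q < j\<close> contradicts the maximality of \<open>i\<close>,
        \<open>q = j\<close> the sign at \<open>j\<close>, and \<open>q > j\<close> crosses
        \<open>X h j\<close>.\<close>
      case 1
      then show False
        using Y c e j i \<open>h < i\<close> max[of q] pos[of q] pos[of j]
        by (cases j q rule: linorder_cases) (auto simp: compatible_def)
    next
      case 2
      then show False using Y c e j i \<open>h < i\<close> by (auto simp: compatible_def)
    qed
  qed
qed

text \<open>Without sinks below \<open>n\<close>, the letters \<open>Y i j\<close> with \<open>j < n\<close> are nested.\<close>

lemma outer_letter:
  assumes f: "compatible_weight n f"
    and nonneg: "\<And>k. k < n \<Longrightarrow> weight_vec n f k \<ge> 0"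
    and A: "A < n" "weight_vec n f A > 0" and B: "B < n" "weight_vec n f B > 0"
    and bounds: "\<And>k. k < n \<Longrightarrow> weight_vec n f k > 0 \<Longrightarrow> A \<le> k \<and> k \<le> B"
    and y: "0 < f (Y i j)" "j < n"
  shows "0 < f (Y A B)"
proof -
  have yl: "1 \<le> i" "i < j" using compatible_weightD(1)[OF f y(1)] by auto
  have pos: "A \<le> k \<and> k \<le> B" if "0 < f e" "root_vec e k > 0" "k < n" for e k
    using weight_vec_pos[OF f that(1,3,2)] bounds that(3) by blast
  have ij: "A \<le> i" "j \<le> B" using pos[OF y(1), of i] pos[OF y(1), of j] y yl by auto
  have nosink: "k = n" if "0 < f (X h k)" for h k
    using nonneg[of k] weight_vec_neg[OF f that, of k] compatible_weightD(1)[OF f that] by force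
  have compat: "compatible n (Y i j) e" if "0 < f e" "e \<noteq> Y i j" for e
    using compatible_weightD(2)[OF f y(1) that(1)] that by auto
  obtain k where k: "0 < f (Y A k)" "k < n"
  proof -
    obtain e where e: "e \<in> letters n" "0 < f e" "root_vec e A > 0" using weight_vec_posE[OF A(2)] .
    \<comment> \<open>A letter positive at \<open>A\<close> is \<open>Y A k\<close> with
      \<open>k < n\<close>, \<open>X A n\<close> or \<open>Y A n\<close>. In the last two cases
      compatibility with \<open>Y i j\<close> forces \<open>i = A\<close>, so \<open>j\<close> is a
      witness. The argument at \<open>B\<close> is the mirror image.\<close>
    have "\<exists>k. 0 < f (Y A k) \<and> k < n"
    proof (cases e)
      case (X p q)
      then have "p = A" "q = n" using e nosink by (auto simp: of_bool_def split: if_splits)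
      then show ?thesis using X compat[OF e(2)] ij yl y by (auto simp: compatible_def intro!: exI[of _ j])
    next
      case (Y p q)
      then consider "p = A" | "q = A" "p < A" using e by (auto simp: of_bool_def split: if_splits)
      then show ?thesis
      proof cases
        case 1
        show ?thesis
        proof (cases "q < n")
          case False
          then have "q = n" using e Y by auto
          then show ?thesis using Y 1 compat[OF e(2)] ij yl y
            by (auto simp: compatible_def intro!: exI[of _ j])
        qed (use Y 1 e in auto)
      next
        case 2
        then show ?thesis using pos[OF e(2), of p] Y A by auto
      qed
    qed
    then show thesis using that by blast
  qed
  obtain h where h: "0 < f (Y h B)"
  proof -
    obtain e where e: "e \<in> letters n" "0 < f e" "root_vec e B > 0" using weight_vec_posE[OF B(2)] .
    have "\<exists>h. 0 < f (Y h B)"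
    proof (cases e)
      case (X p q)
      then have "p = B" "q = n" using e nosink by (auto simp: of_bool_def split: if_splits)
      then show ?thesis using X compat[OF e(2)] ij yl y by (auto simp: compatible_def intro!: exI[of _ i])
    next
      case (Y p q)
      then consider "q = B" | "p = B" "B < q" using e by (auto simp: of_bool_def split: if_splits)
      then show ?thesis
      proof cases
        case 2
        show ?thesis
        proof (cases "q < n")
          case True
          then show ?thesis using pos[OF e(2), of q] Y 2 by auto
        next
          case False
          then have "q = n" using e Y by auto
          then show ?thesis using Y 2 compat[OF e(2)] ij yl y
            by (auto simp: compatible_def intro!: exI[of _ i])
        qed
      qed (use Y e in auto)
    qed
    then show thesis using that by blast
  qed
  have "h < B" "A < k" using compatible_weightD(1)[OF f h] compatible_weightD(1)[OF f k(1)] by auto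
  moreover have "A \<le> h" "k \<le> B" using pos[OF h, of h] pos[OF k(1), of k] B k \<open>h < B\<close> by auto
  moreover have "compatible n (Y A k) (Y h B)" if "Y A k \<noteq> Y h B"
    using compatible_weightD(2)[OF f k(1) h that] .
  \<comment> \<open>Nested letters with \<open>A \<le> h\<close> and \<open>k \<le> B\<close> must
    share an end.\<close>
  ultimately have "h = A \<or> k = B"
    using B k by (cases "Y A k = Y h B") (auto simp: compatible_def)
  then show ?thesis using h k by auto
qed

text \<open>For \<open>s = 1\<close> and \<open>s = -1\<close> this functional vanishes exactly on the letters \<open>X i j\<close> with \<open>j < n\<close> and on
  the letters \<open>X i n\<close>, respectively \<open>Y i n\<close>.\<close>

definition end_sum :: "nat \<Rightarrow> int \<Rightarrow> (nat \<Rightarrow> int) \<Rightarrow> int" where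
  "end_sum n s v = (\<Sum>k = 1..<n. v k) + s * v n"

lemma end_sum_root:
  "X i j \<in> letters n \<Longrightarrow> end_sum n s (root_vec (X i j)) = (if j < n then 0 else 1 - s)"
  "Y i j \<in> letters n \<Longrightarrow> end_sum n s (root_vec (Y i j)) = (if j < n then 2 else 1 + s)"
  by (auto simp: end_sum_def of_bool_def sum_subtractf sum.distrib)

lemma end_sum_weight_vec:
  "end_sum n s (weight_vec n f) = (\<Sum>a \<in> letters n. int (f a) * end_sum n s (root_vec a))"
proof -
  have "(\<Sum>k = 1..<n. weight_vec n f k) = (\<Sum>a \<in> letters n. int (f a) * (\<Sum>k = 1..<n. root_vec a k))"
    unfolding weight_vec_def sum_distrib_left by (rule sum.swap)
  then show ?thesis
    by (simp add: end_sum_def weight_vec_def sum_distrib_left distrib_left sum.distrib ac_simps)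
qed

lemma end_sum_nonneg: "\<bar>s\<bar> \<le> 1 \<Longrightarrow> a \<in> letters n \<Longrightarrow> end_sum n s (root_vec a) \<ge> 0"
  by (cases a) (simp_all only: end_sum_root, auto)

lemma end_sum_weight_vec_pos:
  assumes "compatible_weight n f" "0 < f a" "\<bar>s\<bar> \<le> 1" "end_sum n s (root_vec a) > 0"
  shows "end_sum n s (weight_vec n f) > 0"
  unfolding end_sum_weight_vec
  by (rule sum_pos2[of _ a]) (use assms compatible_weightD(1)[OF assms(1,2)] end_sum_nonneg in auto)

lemma end_sum_weight_vec_zero:
  assumes "\<And>a. a \<in> letters n \<Longrightarrow> 0 < f a \<Longrightarrow> end_sum n s (root_vec a) = 0"
  shows "end_sum n s (weight_vec n f) = 0"
  unfolding end_sum_weight_vec by (rule sum.neutral) (use assms in force)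

lemma no_sink_letter:
  assumes f: "compatible_weight n f" "0 < f (X h k)"
    and nonneg: "\<And>k. k < n \<Longrightarrow> weight_vec n f k \<ge> 0"
  shows "k = n"
  using nonneg[of k] weight_vec_neg[OF f, of k] compatible_weightD(1)[OF f] by force

lemma end_letter:
  assumes f: "compatible_weight n f" "0 < f e"
    and nonneg: "\<And>k. k < n \<Longrightarrow> weight_vec n f k \<ge> 0"
    and no: "\<nexists>p q. 0 < f (Y p q) \<and> q < n"
  shows "\<exists>p. e = X p n \<or> e = Y p n"
proof (cases e)
  case (X p q)
  then show ?thesis using no_sink_letter[OF f(1) _ nonneg] f(2) by auto
next
  case (Y p q)
  then have "q \<le> n" using compatible_weightD(1)[OF f] by simp
  moreover have "\<not> q < n" using no f(2) unfolding Y by blast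
  ultimately show ?thesis using Y by auto
qed

text \<open>\<open>X p n\<close> and \<open>Y q n\<close> with \<open>p \<noteq> q\<close> are
  opposed.\<close>

lemma compatible_ends:
  assumes f: "compatible_weight n f" "0 < f (X p n)" "0 < f (Y q n)"
  shows "p = q"
  using compatible_weightD(2)[OF f] by (auto simp: compatible_def)

text \<open>If \<open>g\<close> also has a letter \<open>Y p q\<close> with \<open>q < n\<close>,
  both contain the outermost one, which the vector determines. Otherwise all letters of
  \<open>g\<close> turn out to start at one index \<open>p\<close>, while the vector is positive at
  both \<open>i\<close> and \<open>j\<close>.\<close>

lemma common_letter_inner:
  assumes f: "compatible_weight n f" and g: "compatible_weight n g"
    and eq: "weight_vec n f = weight_vec n g"
    and nonneg: "\<And>k. k < n \<Longrightarrow> weight_vec n f k \<ge> 0"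
    and y: "0 < f (Y i j)" "j < n"
  shows "\<exists>c. 0 < f c \<and> 0 < g c"
proof (cases "\<exists>p q. 0 < g (Y p q) \<and> q < n")
  case True
  then obtain p q where pq: "0 < g (Y p q)" "q < n" by blast
  let ?S = "{k. k < n \<and> weight_vec n f k > 0}"
  have "i < n" using compatible_weightD(1)[OF f y(1)] by auto
  then have "i \<in> ?S" using weight_vec_pos[OF f y(1), of i] by auto
  then have S: "Min ?S \<in> ?S" "Max ?S \<in> ?S" by (intro Min_in Max_in; auto)+
  have bounds: "Min ?S \<le> k \<and> k \<le> Max ?S" if "k < n" "weight_vec n f k > 0" for k
    using that by (auto intro!: Min_le Max_ge)
  have "0 < f (Y (Min ?S) (Max ?S))"
    by (rule outer_letter[OF f nonneg _ _ _ _ _ y]) (use S bounds in auto)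
  moreover have "0 < g (Y (Min ?S) (Max ?S))"
    by (rule outer_letter[OF g _ _ _ _ _ _ pq]) (use S bounds nonneg eq in auto)
  ultimately show ?thesis by blast
next
  case False
  have ends: "\<exists>p. e = X p n \<or> e = Y p n" if "0 < g e" for e
    using end_letter[OF g that] nonneg eq False by simp
  have yl: "Y i j \<in> letters n" using compatible_weightD(1)[OF f y(1)] .
  \<comment> \<open>Since \<open>Y i j\<close> has value 2 for every \<open>s\<close>, the sign
    \<open>s = -1\<close> yields an \<open>X p n\<close> in \<open>g\<close> and
    \<open>s = 1\<close> a \<open>Y q n\<close>.\<close>
  have T: "end_sum n s (weight_vec n g) > 0" if "\<bar>s\<bar> \<le> 1" for s
    unfolding eq[symmetric]
    by (rule end_sum_weight_vec_pos[OF f y(1) that]) (use end_sum_root(2)[OF yl] y in simp)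
  have "\<exists>p. 0 < g (X p n)"
  proof (rule ccontr)
    assume no: "\<not> ?thesis"
    have "end_sum n (-1) (weight_vec n g) = 0"
    proof (rule end_sum_weight_vec_zero)
      fix e assume e: "e \<in> letters n" "0 < g e"
      obtain p where "e = X p n \<or> e = Y p n" using ends[OF e(2)] ..
      moreover have "e \<noteq> X p n" using no e(2) by blast
      ultimately show "end_sum n (-1) (root_vec e) = 0"
        using e(1) end_sum_root(2) by auto
    qed
    then show False using T[of "-1"] by simp
  qed
  then obtain p where p: "0 < g (X p n)" ..
  have "\<exists>q. 0 < g (Y q n)"
  proof (rule ccontr)
    assume no: "\<not> ?thesis"
    have "end_sum n 1 (weight_vec n g) = 0"
    proof (rule end_sum_weight_vec_zero)
      fix e assume e: "e \<in> letters n" "0 < g e"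
      obtain p where "e = X p n \<or> e = Y p n" using ends[OF e(2)] ..
      moreover have "e \<noteq> Y p n" using no e(2) by blast
      ultimately show "end_sum n 1 (root_vec e) = 0"
        using e(1) end_sum_root(1) by auto
    qed
    then show False using T[of 1] by simp
  qed
  then obtain q where q: "0 < g (Y q n)" ..
  have at: "k = p" if k: "k < n" "weight_vec n g k > 0" for k
  proof -
    obtain e where e: "e \<in> letters n" "0 < g e" "root_vec e k > 0" using weight_vec_posE[OF k(2)] .
    obtain r where "e = X r n \<or> e = Y r n" using ends[OF e(2)] ..
    then show ?thesis
    proof
      assume "e = X r n"
      moreover from this have "r = q" using compatible_ends[OF g _ q] e(2) by blast
      moreover have "p = q" using compatible_ends[OF g p q] .
      ultimately show ?thesis using e(3) by (auto simp: of_bool_def split: if_splits)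
    next
      assume "e = Y r n"
      moreover from this have "p = r" using compatible_ends[OF g p] e(2) by blast
      ultimately show ?thesis using e(3) k by (auto simp: of_bool_def split: if_splits)
    qed
  qed
  have "i = p" "j = p"
    using at[of i] at[of j] weight_vec_pos[OF f y(1), of i] weight_vec_pos[OF f y(1), of j] yl y eq
    by auto
  then show ?thesis using yl by simp
qed

text \<open>Covers the case where \<open>f\<close> and \<open>g\<close> have different letters at
  \<open>A\<close>: without \<open>Y A n\<close>, all letters of \<open>f\<close> are of the form
  \<open>X p n\<close>, and \<open>end_sum\<close> with \<open>s = 1\<close> vanishes on
  \<open>f\<close> but not on \<open>g\<close>.\<close>

lemma ends_differ:
  assumes f: "compatible_weight n f" and g: "compatible_weight n g"
    and eq: "weight_vec n f = weight_vec n g"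
    and ends: "\<And>e. 0 < f e \<Longrightarrow> \<exists>p. e = X p n \<or> e = Y p n"
    and A: "0 < f (X A n)" "0 < g (Y A n)"
  shows "0 < f (Y A n)"
proof (rule ccontr)
  assume no: "\<not> 0 < f (Y A n)"
  have "end_sum n 1 (weight_vec n f) = 0"
  proof (rule end_sum_weight_vec_zero)
    fix e assume e: "e \<in> letters n" "0 < f e"
    obtain p where "e = X p n \<or> e = Y p n" using ends[OF e(2)] ..
    then show "end_sum n 1 (root_vec e) = 0"
      using e no compatible_ends[OF f A(1)] end_sum_root(1) by auto
  qed
  moreover have "end_sum n 1 (weight_vec n g) > 0"
    by (rule end_sum_weight_vec_pos[OF g A(2)])
      (use end_sum_root(2)[OF compatible_weightD(1)[OF g A(2)]] in auto)
  ultimately show False using eq by simp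
qed

text \<open>Three cases: a negative entry below \<open>n\<close> (\<open>sink_letter\<close>), a
  \<open>Y i j\<close> with \<open>j < n\<close> (\<open>common_letter_inner\<close>), or only
  letters ending in \<open>n\<close>.\<close>

lemma common_letter:
  assumes f: "compatible_weight n f" and g: "compatible_weight n g"
    and eq: "weight_vec n f = weight_vec n g" and a: "0 < f a"
  shows "\<exists>c. 0 < f c \<and> 0 < g c"
proof (cases "\<exists>j<n. weight_vec n f j < 0")
  case True
  define j where "j = (LEAST j. j < n \<and> weight_vec n f j < 0)"
  have j: "j < n" "weight_vec n f j < 0"
    using LeastI_ex[OF True] by (auto simp: j_def)
  have nonneg: "weight_vec n f k \<ge> 0" if "k < j" for k
    using not_less_Least[of k "\<lambda>j. j < n \<and> weight_vec n f j < 0"] that j by (force simp: j_def)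
  obtain h where h: "X h j \<in> letters n" "0 < f (X h j)" using weight_vec_negE[OF j(2)] .
  let ?S = "{k. k < j \<and> weight_vec n f k > 0}"
  have "h \<in> ?S" using h j weight_vec_pos[OF f h(2), of h] by auto
  then have S: "Max ?S \<in> ?S" by (intro Max_in) auto
  have max: "k \<le> Max ?S" if "k < j" "weight_vec n f k > 0" for k
    using that by (auto intro!: Max_ge)
  have "0 < f (X (Max ?S) j)"
    by (rule sink_letter[OF f j nonneg]) (use S max in auto)
  moreover have "0 < g (X (Max ?S) j)"
    by (rule sink_letter[OF g]) (use j nonneg S max eq in auto)
  ultimately show ?thesis by blast
next
  case False
  then have nonneg: "weight_vec n f k \<ge> 0" if "k < n" for k using that by force
  show ?thesis
  proof (cases "\<exists>i j. j < n \<and> (0 < f (Y i j) \<or> 0 < g (Y i j))")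
    case True
    then show ?thesis
      using common_letter_inner[OF f g eq nonneg] common_letter_inner[OF g f eq[symmetric]] nonneg eq
      by metis
  next
    case False
    have ends_f: "\<exists>p. e = X p n \<or> e = Y p n" if "0 < f e" for e
      using end_letter[OF f that nonneg] False by blast
    have ends_g: "\<exists>p. e = X p n \<or> e = Y p n" if "0 < g e" for e
      using end_letter[OF g that] nonneg eq False by auto
    obtain A where A: "a = X A n \<or> a = Y A n" using ends_f[OF a] ..
    then have "A < n" using compatible_weightD(1)[OF f a] by auto
    moreover have "weight_vec n g A > 0"
      using weight_vec_pos[OF f a \<open>A < n\<close>] A \<open>A < n\<close> eq by auto
    ultimately obtain e where e: "e \<in> letters n" "0 < g e" "root_vec e A > 0"
      using weight_vec_posE by blast
    then have "e = X A n \<or> e = Y A n"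
      using ends_g[OF e(2)] \<open>A < n\<close> by (auto simp: of_bool_def split: if_splits)
    then show ?thesis
      using A a e(2) ends_differ[OF f g eq ends_f] ends_differ[OF g f eq[symmetric] ends_g] by metis
  qed
qed

text \<open>Induction on the total weight of \<open>f\<close>, removing one copy of a common letter
  from both sides.\<close>

lemma compatible_weight_unique:
  assumes "compatible_weight n f" "compatible_weight n g" "weight_vec n f = weight_vec n g"
  shows "f = g"
  using assms
proof (induction "\<Sum>a \<in> letters n. f a" arbitrary: f g rule: less_induct)
  case less
  show ?case
  proof (cases "\<exists>c. 0 < f c \<or> 0 < g c")
    case True
    then obtain c where c: "0 < f c" "0 < g c"
      \<comment> \<open>Only one of \<open>f\<close>, \<open>g\<close> is known to be nonzero, hence
        both directions.\<close>
      using common_letter[OF less.prems] common_letter[OF less.prems(2,1) less.prems(3)[symmetric]]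
      by blast
    have cl: "c \<in> letters n" using compatible_weightD(1)[OF less.prems(1) c(1)] .
    define f' g' where "f' = f(c := f c - 1)" and "g' = g(c := g c - 1)"
    have sub: "{a. 0 < f' a} \<subseteq> {a. 0 < f a}" "{a. 0 < g' a} \<subseteq> {a. 0 < g a}"
      by (auto simp: f'_def g'_def)
    have vec: "weight_vec n (h(c := h c - 1)) = (\<lambda>k. weight_vec n h k - root_vec c k)"
      if "0 < h c" for h
    proof
      fix k
      have "int ((h(c := h c - 1)) a) * root_vec a k =
          int (h a) * root_vec a k - (if a = c then root_vec a k else 0)" for a
        using that by (auto simp: algebra_simps of_nat_diff)
      then show "weight_vec n (h(c := h c - 1)) k = weight_vec n h k - root_vec c k"
        using cl by (simp add: weight_vec_def sum_subtractf)
    qed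
    have "f' = g'"
    proof (rule less.hyps)
      show "sum f' (letters n) < sum f (letters n)"
        using c cl by (intro sum_strict_mono_ex1) (auto simp: f'_def)
      show "compatible_weight n f'" "compatible_weight n g'"
        using less.prems(1,2) sub by (auto simp: compatible_weight_def intro: pairwise_subset)
      show "weight_vec n f' = weight_vec n g'"
        unfolding f'_def g'_def vec[of f, OF c(1)] vec[of g, OF c(2)] using less.prems(3) by simp
    qed
    have "f a = g a" for a
      using fun_cong[OF \<open>f' = g'\<close>, of a] c
      by (cases "a = c") (auto simp add: f'_def g'_def simp del: One_nat_def)
    then show ?thesis by auto
  qed auto
qed

subsection \<open>The invariant functionals\<close>

fun weighted_sum :: "nat list \<Rightarrow> letter list \<Rightarrow> nat \<Rightarrow> int" where
  "weighted_sum (l # ls) (a # w) k = int l * root_vec a k + weighted_sum ls w k"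
| "weighted_sum _ _ k = 0"

text \<open>Coefficients belong to positions, not letters, so that a factor of the word can be
  treated separately.\<close>

definition solutions :: "letter list \<Rightarrow> (nat \<Rightarrow> int) \<Rightarrow> nat list set" where
  "solutions w p = {ls. length ls = length w \<and> 0 \<notin> set ls \<and> (\<forall>k. weighted_sum ls w k = p k)}"

lemma weighted_sum_append:
  "length l1 = length u \<Longrightarrow> weighted_sum (l1 @ l2) (u @ v) k = weighted_sum l1 u k + weighted_sum l2 v k"
  by (induction l1 u rule: list_induct2) auto

text \<open>A functional that is at least 1 on every letter; it bounds the coefficients and makes
  \<open>solutions\<close> finite, so that \<open>card\<close> really counts.\<close>

definition height :: "nat \<Rightarrow> (nat \<Rightarrow> int) \<Rightarrow> int" where
  "height n v = (\<Sum>k = 1..n. int (n + 1 - k) * v k)"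

lemma height_root_pos:
  assumes "a \<in> letters n"
  shows "height n (root_vec a) \<ge> 1"
proof -
  have "(\<Sum>k = 1..n. int (n + 1 - k) * of_bool (k = i)) = int (n + 1 - i)" if "i \<in> {1..n}" for i
  proof -
    have "(\<Sum>k = 1..n. int (n + 1 - k) * of_bool (k = i)) =
        (\<Sum>k = 1..n. if k = i then int (n + 1 - k) else 0)"
      by (rule sum.cong) auto
    then show ?thesis using that by simp
  qed
  then show ?thesis
    using assms
    by (cases a) (simp_all add: height_def right_diff_distrib distrib_left sum_subtractf sum.distrib)
qed

lemma sum_list_le_height:
  assumes "length ls = length w" "set w \<subseteq> letters n"
  shows "int (sum_list ls) \<le> height n (weighted_sum ls w)"
  using assms
proof (induction ls w rule: list_induct2)
  case (Cons l ls a w)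
  have "height n (weighted_sum (l # ls) (a # w)) =
      int l * height n (root_vec a) + height n (weighted_sum ls w)"
    by (simp add: height_def distrib_left sum.distrib sum_distrib_left ac_simps)
  moreover have "int l * 1 \<le> int l * height n (root_vec a)"
    using Cons.prems height_root_pos by (intro mult_left_mono) auto
  ultimately show ?case using Cons.IH Cons.prems by (simp del: weighted_sum.simps)
qed (simp add: height_def)

lemma solutions_bound:
  assumes "set w \<subseteq> letters n" "ls \<in> solutions w p" "l \<in> set ls"
  shows "l \<in> {1..nat (height n p)}"
proof -
  have "weighted_sum ls w = p" using assms(2) by (auto simp: solutions_def)
  then have "int (sum_list ls) \<le> height n p"
    using sum_list_le_height[of ls w n] assms by (auto simp: solutions_def)
  moreover have "l \<le> sum_list ls" using assms(3) by (simp add: member_le_sum_list)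
  moreover have "l \<noteq> 0" using assms(2,3) by (auto simp: solutions_def intro: ccontr)
  ultimately show ?thesis by auto
qed

lemma finite_solutions: "set w \<subseteq> letters n \<Longrightarrow> finite (solutions w p)"
  by (rule finite_subset[OF _ finite_lists_length_eq[of "{1..nat (height n p)}" "length w"]])
    (use solutions_bound in \<open>auto simp: solutions_def\<close>)

text \<open>Fixing the coefficients on \<open>u\<close> and \<open>v\<close> leaves a problem for
  \<open>m\<close> with a shifted vector. The bound in \<open>B\<close> is independent of
  \<open>m\<close>, so sums for different \<open>m\<close> can be compared termwise.\<close>

lemma card_solutions_context:
  fixes p :: "nat \<Rightarrow> int" and B :: "letter list \<Rightarrow> nat list set"
  assumes "set (u @ m @ v) \<subseteq> letters n"
  defines "B \<equiv> \<lambda>w. {ls. set ls \<subseteq> {1..nat (height n p)} \<and> length ls = length w}"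
  shows "card (solutions (u @ m @ v) p) =
    (\<Sum>(l1, l2) \<in> B u \<times> B v. card (solutions m (\<lambda>k. p k - weighted_sum l1 u k - weighted_sum l2 v k)))"
proof -
  let ?S = "\<lambda>(l1, l2). solutions m (\<lambda>k. p k - weighted_sum l1 u k - weighted_sum l2 v k)"
  have fin: "finite (B w)" for w unfolding B_def by (rule finite_lists_length_eq) simp
  have ws: "weighted_sum (l1 @ l @ l2) (u @ m @ v) k = weighted_sum l1 u k + weighted_sum l m k + weighted_sum l2 v k"
    if "length l1 = length u" "length l = length m" for l1 l l2 k
    using that by (simp add: weighted_sum_append)
  have "bij_betw (\<lambda>((l1, l2), l). l1 @ l @ l2) (Sigma (B u \<times> B v) ?S) (solutions (u @ m @ v) p)"
  proof (rule bij_betw_imageI)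
    show "inj_on (\<lambda>((l1, l2), l). l1 @ l @ l2) (Sigma (B u \<times> B v) ?S)"
      by (auto simp: inj_on_def B_def solutions_def)
    show "(\<lambda>((l1, l2), l). l1 @ l @ l2) ` Sigma (B u \<times> B v) ?S = solutions (u @ m @ v) p"
    proof (intro set_eqI iffI)
      fix ls assume "ls \<in> (\<lambda>((l1, l2), l). l1 @ l @ l2) ` Sigma (B u \<times> B v) ?S"
      then obtain l1 l2 l where l: "ls = l1 @ l @ l2" "l1 \<in> B u" "l2 \<in> B v" "l \<in> ?S (l1, l2)" by auto
      then have "0 \<notin> set l1" "0 \<notin> set l2" by (force simp: B_def)+
      then show "ls \<in> solutions (u @ m @ v) p"
        using l by (simp add: solutions_def ws B_def)
    next
      fix ls assume ls: "ls \<in> solutions (u @ m @ v) p"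
      define l1 r where "l1 = take (length u) ls" and "r = drop (length u) ls"
      define l l2 where "l = take (length m) r" and "l2 = drop (length m) r"
      have split: "ls = l1 @ l @ l2"
        unfolding l1_def l_def l2_def r_def by (simp only: append_take_drop_id)
      have len: "length l1 = length u" "length l = length m" "length l2 = length v"
        using ls by (auto simp: l1_def r_def l_def l2_def solutions_def)
      have "set ls \<subseteq> {1..nat (height n p)}" using solutions_bound[OF assms(1) ls] by blast
      then have "l1 \<in> B u" "l2 \<in> B v" by (auto simp: B_def len split)
      moreover have "l \<in> ?S (l1, l2)"
        using ls ws[OF len(1,2)] len by (auto simp: solutions_def split algebra_simps)
      ultimately show "ls \<in> (\<lambda>((l1, l2), l). l1 @ l @ l2) ` Sigma (B u \<times> B v) ?S"
        unfolding split by (intro image_eqI[of _ _ "((l1, l2), l)"]) auto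
    qed
  qed
  then have "card (solutions (u @ m @ v) p) = card (Sigma (B u \<times> B v) ?S)"
    by (rule bij_betw_same_card[symmetric])
  also have "\<dots> = (\<Sum>x \<in> B u \<times> B v. card (?S x))"
    by (rule card_SigmaI) (use fin assms(1) in \<open>auto intro!: finite_solutions\<close>)
  finally show ?thesis by (simp add: case_prod_unfold)
qed

lemma solutions_pair: "ls \<in> solutions [a, b] q \<longleftrightarrow>
    (\<exists>s t. ls = [s, t] \<and> 0 < s \<and> 0 < t \<and> (\<forall>k. int s * root_vec a k + int t * root_vec b k = q k))"
  by (auto simp: solutions_def length_Suc_conv)

lemma solutions_single: "ls \<in> solutions [a] q \<longleftrightarrow>
    (\<exists>s. ls = [s] \<and> 0 < s \<and> (\<forall>k. int s * root_vec a k = q k))"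
  by (auto simp: solutions_def length_Suc_conv)

lemma card_solutions_commute: "card (solutions [a, b] q) = card (solutions [b, a] q)"
  by (rule bij_betw_same_card[of rev], rule bij_betw_byWitness[where f' = rev])
    (auto simp: solutions_pair add.commute)

text \<open>A positive combination \<open>s a + t b\<close> is one of \<open>c, a\<close>, of \<open>b, c\<close> or of \<open>c\<close> alone according as
  \<open>s > t\<close>, \<open>s < t\<close> or \<open>s = t\<close>.\<close>

lemma card_solutions_rule:
  assumes ab: "{a, b} \<subseteq> letters n" and c: "\<And>k. root_vec c k = root_vec a k + root_vec b k"
  shows "card (solutions [a, b] q) =
    card (solutions [c, a] q) + card (solutions [b, c] q) + card (solutions [c] q)"
proof -
  \<comment> \<open>These turn coefficients for \<open>[c, a]\<close>, \<open>[b, c]\<close> and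
    \<open>[c]\<close> into coefficients for \<open>[a, b]\<close> by expanding \<open>c\<close> as
    \<open>a + b\<close>.\<close>
  let ?f1 = "\<lambda>ls :: nat list. [ls ! 0 + ls ! 1, ls ! 0]"
  let ?f2 = "\<lambda>ls :: nat list. [ls ! 1, ls ! 0 + ls ! 1]"
  let ?f3 = "\<lambda>ls :: nat list. [ls ! 0, ls ! 0]"
  let ?A1 = "?f1 ` solutions [c, a] q" and ?A2 = "?f2 ` solutions [b, c] q" and ?A3 = "?f3 ` solutions [c] q"
  have eq: "solutions [a, b] q = ?A1 \<union> ?A2 \<union> ?A3"
  proof (intro set_eqI iffI)
    fix ls assume "ls \<in> solutions [a, b] q"
    then obtain s t where st: "ls = [s, t]" "0 < s" "0 < t"
      "\<And>k. int s * root_vec a k + int t * root_vec b k = q k" by (auto simp: solutions_pair)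
    consider "s > t" | "s < t" | "s = t" by linarith
    then show "ls \<in> ?A1 \<union> ?A2 \<union> ?A3"
    proof cases
      case 1
      then have "[t, s - t] \<in> solutions [c, a] q"
        using st by (auto simp: solutions_pair c of_nat_diff algebra_simps)
      then have "?f1 [t, s - t] \<in> ?A1" by (rule imageI)
      then show ?thesis using 1 st(1) by simp
    next
      case 2
      then have "[t - s, s] \<in> solutions [b, c] q"
        using st by (auto simp: solutions_pair c of_nat_diff algebra_simps)
      then have "?f2 [t - s, s] \<in> ?A2" by (rule imageI)
      then show ?thesis using 2 st(1) by simp
    next
      case 3
      then have "[s] \<in> solutions [c] q"
        using st by (auto simp: solutions_single c algebra_simps)
      then have "?f3 [s] \<in> ?A3" by (rule imageI)
      then show ?thesis using 3 st(1) by simp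
    qed
  next
    fix ls assume "ls \<in> ?A1 \<union> ?A2 \<union> ?A3"
    then show "ls \<in> solutions [a, b] q"
      by (auto simp: solutions_pair solutions_single c algebra_simps)
  qed
  have "finite (solutions [a, b] q)" using ab by (intro finite_solutions) auto
  then have fin: "finite ?A1" "finite ?A2" "finite ?A3" unfolding eq by auto
  have "card (solutions [a, b] q) = card ?A1 + card ?A2 + card ?A3"
    unfolding eq using fin
    by (subst card_Un_disjoint; (subst card_Un_disjoint)?)
      (auto simp: solutions_pair solutions_single)
  moreover have "card ?A1 = card (solutions [c, a] q)" "card ?A2 = card (solutions [b, c] q)"
    "card ?A3 = card (solutions [c] q)"
    by (rule card_image, auto simp: inj_on_def solutions_pair solutions_single)+
  ultimately show ?thesis by simp
qed

text \<open>The power of \<open>\<beta>\<close> is the length because the term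
  \<open>\<beta> c\<close> of a rule is one letter shorter than the others.\<close>

definition word_value :: "(nat \<Rightarrow> int) \<Rightarrow> letter list \<Rightarrow> rat poly" where
  "word_value p w = monom (of_nat (card (solutions w p))) (length w)"

definition linear_ext :: "(letter list \<Rightarrow> rat poly) \<Rightarrow> ncpoly \<Rightarrow> rat poly" where
  "linear_ext e f = (\<Sum>x \<in> Poly_Mapping.keys f. Poly_Mapping.lookup f x * (case x of Word w \<Rightarrow> e w))"

lemma linear_ext_superset:
  assumes "finite A" "Poly_Mapping.keys f \<subseteq> A"
  shows "linear_ext e f = (\<Sum>x \<in> A. Poly_Mapping.lookup f x * (case x of Word w \<Rightarrow> e w))"
  unfolding linear_ext_def by (rule sum.mono_neutral_left) (use assms in \<open>auto simp: in_keys_iff\<close>)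

lemma linear_ext_add: "linear_ext e (f + g) = linear_ext e f + linear_ext e g"
  using Poly_Mapping.keys_add[of f g]
  by (simp add: linear_ext_superset[of "Poly_Mapping.keys f \<union> Poly_Mapping.keys g"]
      lookup_add distrib_right sum.distrib)

lemma linear_ext_diff: "linear_ext e (f - g) = linear_ext e f - linear_ext e g"
  using linear_ext_add[of e "f - g" g] by simp

lemma linear_ext_single: "linear_ext e (Poly_Mapping.single (Word w) c) = c * e w"
  by (subst linear_ext_superset[of "{Word w}"]) auto

lemma word_value_commute:
  assumes "set (u @ [a, b] @ v) \<subseteq> letters n"
  shows "word_value p (u @ [a, b] @ v) = word_value p (u @ [b, a] @ v)"
proof -
  have "set (u @ [b, a] @ v) \<subseteq> letters n" using assms by auto
  from card_solutions_context[OF this, of p] card_solutions_context[OF assms, of p]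
  show ?thesis by (simp add: word_value_def card_solutions_commute[of a b] del: append_Cons)
qed

lemma word_value_rule:
  assumes l: "set (u @ [a, b] @ v) \<subseteq> letters n" "c \<in> letters n"
    and c: "\<And>k. root_vec c k = root_vec a k + root_vec b k"
  shows "word_value p (u @ [a, b] @ v) = word_value p (u @ [c, a] @ v) +
    word_value p (u @ [b, c] @ v) + [:0, 1:] * word_value p (u @ [c] @ v)"
proof -
  have l': "set (u @ [c, a] @ v) \<subseteq> letters n" "set (u @ [b, c] @ v) \<subseteq> letters n"
    "set (u @ [c] @ v) \<subseteq> letters n" "{a, b} \<subseteq> letters n" using l by auto
  have "card (solutions (u @ [a, b] @ v) p) = card (solutions (u @ [c, a] @ v) p) +
      card (solutions (u @ [b, c] @ v) p) + card (solutions (u @ [c] @ v) p)"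
    unfolding card_solutions_context[OF l(1)] card_solutions_context[OF l'(1)]
      card_solutions_context[OF l'(2)] card_solutions_context[OF l'(3)]
    by (simp only: card_solutions_rule[OF l'(4) c] case_prod_unfold sum.distrib)
  then show ?thesis
    by (simp add: word_value_def add_monom flip: monom_Suc)
qed

section \<open>Invariance along reduction steps\<close>

definition good_poly :: "nat \<Rightarrow> ncpoly \<Rightarrow> bool" where
  "good_poly n f \<longleftrightarrow> (\<forall>w. coeff_of f w \<noteq> 0 \<longrightarrow> good n w)"

lemma good_poly_add: "good_poly n f \<Longrightarrow> good_poly n g \<Longrightarrow> good_poly n (f + g)"
  unfolding good_poly_def coeff_of_def lookup_add by (metis add_0_left)

lemma good_poly_diff: "good_poly n f \<Longrightarrow> good_poly n g \<Longrightarrow> good_poly n (f - g)"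
  unfolding good_poly_def coeff_of_def lookup_minus by (metis diff_self)

lemma good_poly_single: "good n w \<Longrightarrow> good_poly n (Poly_Mapping.single (Word w) c)"
  by (auto simp: good_poly_def coeff_of_def lookup_single when_def)

lemma scalar_mult_mon: "scalar c * mon w = Poly_Mapping.single (Word w) c"
  by (simp add: scalar_def mon_def mult_single zero_nc_word_def)

lemma scalar_mult_rule:
  "scalar d * (mon u * (mon s + mon t + beta * mon r) * mon v) =
    Poly_Mapping.single (Word (u @ s @ v)) d + Poly_Mapping.single (Word (u @ t @ v)) d +
    Poly_Mapping.single (Word (u @ r @ v)) (d * [:0, 1:])"
  by (simp add: scalar_def mon_def beta_def mult_single zero_nc_word_def distrib_left distrib_right)

lemma good_rule:
  assumes "good n (u @ [a, b] @ v)" "c \<in> letters n" "sum_closed n a b c"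
  shows "good n (u @ [c, a] @ v)" "good n (u @ [b, c] @ v)" "good n (u @ [c] @ v)"
  using assms by (auto simp: good_def sorted_wrt_append sum_closed_def)

lemma word_value_swap:
  assumes "swap n w w'" "good n w"
  shows "word_value p w = word_value p w'"
  using assms(1)
proof cases
  case (1 a b u v)
  then show ?thesis
    using assms(2) word_value_commute[of u a b v n p] by (simp only: good_def)
qed

lemma word_value_swap_rtranclp:
  "(swap n)\<^sup>*\<^sup>* w w' \<Longrightarrow> good n w \<Longrightarrow> word_value p w = word_value p w'"
proof (induction rule: rtranclp_induct)
  case (step y z)
  then show ?case using word_value_swap[of n y z p] good_swap_rtranclp[of n w y] by simp
qed simp

text \<open>The two claims go together: goodness keeps all letters in \<open>letters n\<close>, as
  the identities for \<open>word_value\<close> require.\<close>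

lemma step_invariant:
  assumes "step n f g" "good_poly n f"
  shows "good_poly n g \<and> linear_ext (word_value p) g = linear_ext (word_value p) f"
  using assms(1)
proof cases
  case (commute w d w')
  then have w: "good n w" using assms(2) by (auto simp: good_poly_def)
  then have w': "good n w'" using commute good_swap by blast
  have "word_value p w = word_value p w'"
    using \<open>swap n w w'\<close> w by (rule word_value_swap)
  then show ?thesis
    unfolding commute scalar_mult_mon
    using good_poly_add good_poly_diff good_poly_single w w' assms(2)
    by (simp add: linear_ext_add linear_ext_diff linear_ext_single)
next
  case (reduce u l v d r)
  obtain a b c where abc: "l = [a, b]" "{a, b, c} \<subseteq> letters n"
    "r = mon [c, a] + mon [b, c] + beta * mon [c]"
    "\<forall>k. root_vec c k = root_vec a k + root_vec b k" "sum_closed n a b c"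
    using rule_shape[OF \<open>rule n l r\<close>] by blast
  have w: "good n (u @ [a, b] @ v)" using reduce assms(2) abc(1) by (auto simp: good_poly_def)
  note w' = good_rule[OF w _ abc(5)]
  have "word_value p (u @ [a, b] @ v) = word_value p (u @ [c, a] @ v) +
      word_value p (u @ [b, c] @ v) + [:0, 1:] * word_value p (u @ [c] @ v)"
    by (rule word_value_rule) (use w abc in \<open>auto simp: good_def\<close>)
  then show ?thesis
    unfolding reduce(1) abc(1,3) scalar_mult_mon scalar_mult_rule
    using good_poly_add good_poly_diff good_poly_single w w' assms(2) abc(2)
    by (simp add: linear_ext_add linear_ext_diff linear_ext_single algebra_simps del: append_Cons)
qed

lemma steps_invariant:
  assumes "(step n)\<^sup>*\<^sup>* f g" "good_poly n f"
  shows "good_poly n g \<and> linear_ext (word_value p) g = linear_ext (word_value p) f"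
  using assms
proof (induction rule: rtranclp_induct)
  case (step g h)
  then show ?case using step_invariant[of n g h p] by simp
qed simp

lemma good_w_D:
  assumes "n \<ge> 2"
  shows "good n (w_D n)"
proof -
  have "sorted_wrt (\<lambda>i j. may_precede n (X i (i + 1)) (X j (j + 1))) [1..<n]"
    by (rule sorted_wrt_mono_rel[OF _ sorted_wrt_upt]) auto
  then have "sorted_wrt (may_precede n) (map (\<lambda>i. X i (i + 1)) [1..<n])" by (simp add: sorted_wrt_map)
  moreover have "may_precede n (X i (i + 1)) (Y (n - 1) n)" if "i \<in> {1..<n}" for i
    using that by auto
  ultimately show ?thesis
    using assms by (auto simp: good_def w_D_def sorted_wrt_append simp del: may_precede.simps)
qed

subsection \<open>The ideal of commutation relations\<close>

lemma mon_append: "mon (u @ v) = mon u * mon v"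
  by (simp add: mon_def mult_single)

text \<open>The coefficient \<open>c\<close> is absorbed into the left factor of a
  generator.\<close>

lemma swap_comm_ideal:
  "(swap n)\<^sup>*\<^sup>* w w' \<Longrightarrow>
    Poly_Mapping.single (Word w) c - Poly_Mapping.single (Word w') c \<in> comm_ideal n"
proof (induction rule: rtranclp_induct)
  case (step y z)
  from step.hyps(2) have "scalar c * (mon y - mon z) \<in> comm_ideal n"
  proof cases
    case (1 a b u v)
    then have "scalar c * mon u * (mon [a, b] - mon [b, a]) * mon v \<in> comm_ideal n"
      by (intro comm_ideal.gen)
    then show ?thesis
      by (simp only: 1 mon_append left_diff_distrib right_diff_distrib mult.assoc)
  qed
  from comm_ideal.add[OF step.IH this] show ?case
    by (simp add: right_diff_distrib scalar_mult_mon)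
qed (simp add: comm_ideal.zero)

lemma comm_ideal_sum: "(\<And>x. x \<in> A \<Longrightarrow> f x \<in> comm_ideal n) \<Longrightarrow> sum f A \<in> comm_ideal n"
  by (induction A rule: infinite_finite_induct) (auto intro: comm_ideal.intros)

text \<open>Subtracting from each term the same multiple of a representative of its class changes
  nothing in total, as the class sums vanish, and writes \<open>f\<close> as a sum of elements of
  the ideal.\<close>

lemma class_sums_zero_comm_ideal:
  assumes "\<And>w. (\<Sum>x \<in> {x \<in> Poly_Mapping.keys f. \<exists>w'. x = Word w' \<and> (swap n)\<^sup>*\<^sup>* w w'}. Poly_Mapping.lookup f x) = 0"
  shows "f \<in> comm_ideal n"
proof -
  \<comment> \<open>Equivalent words have the same class, so \<open>SOME\<close> chooses the same
    representative.\<close>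
  define rep where "rep w = (SOME w'. (swap n)\<^sup>*\<^sup>* w w')" for w
  have rep: "(swap n)\<^sup>*\<^sup>* w (rep w)" for w
    unfolding rep_def by (rule someI[of _ w]) simp
  have rep_eq: "rep w = rep w'" if "(swap n)\<^sup>*\<^sup>* w w'" for w w'
  proof -
    have "(swap n)\<^sup>*\<^sup>* w = (swap n)\<^sup>*\<^sup>* w'"
      using that swap_rtranclp_sym by (intro ext) (meson rtranclp_trans)
    then show ?thesis by (simp add: rep_def)
  qed
  let ?rep = "\<lambda>x. case x of Word w \<Rightarrow> Word (rep w)"
  let ?s = "\<lambda>g. \<Sum>x \<in> Poly_Mapping.keys f. Poly_Mapping.single (g x) (Poly_Mapping.lookup f x)"
  have "?s ?rep = 0"
  proof (rule poly_mapping_eqI)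
    fix x :: "letter nc_word"
    obtain w0 where x: "x = Word w0" by (cases x)
    have "Poly_Mapping.lookup (?s ?rep) x = (\<Sum>y \<in> Poly_Mapping.keys f. if ?rep y = x then Poly_Mapping.lookup f y else 0)"
      by (simp add: lookup_sum lookup_single when_def)
    also have "\<dots> = (\<Sum>y \<in> {y \<in> Poly_Mapping.keys f. ?rep y = x}. Poly_Mapping.lookup f y)"
      by (simp add: sum.inter_filter)
    also have "\<dots> = 0"
    proof (cases "\<exists>w. ?rep (Word w) = x")
      case True
      then obtain w where w: "rep w = w0" using x by auto
      have "?rep y = x \<longleftrightarrow> (\<exists>w'. y = Word w' \<and> (swap n)\<^sup>*\<^sup>* w w')" for y
      proof (cases y)
        case (Word w')
        have "(swap n)\<^sup>*\<^sup>* w w'" if "rep w' = rep w"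
          using rep[of w] rep[of w'] that swap_rtranclp_sym rtranclp_trans by metis
        then show ?thesis using Word w x rep_eq by auto
      qed
      then show ?thesis using assms[of w] by simp
    next
      case False
      then have "?rep y \<noteq> x" for y by (cases y) auto
      then show ?thesis by (simp only: simp_thms Collect_empty_eq[THEN iffD2] sum.empty)
    qed
    finally show "Poly_Mapping.lookup (?s ?rep) x = Poly_Mapping.lookup 0 x" by simp
  qed
  moreover have "f = ?s (\<lambda>x. x)"
    by (rule poly_mapping_eqI)
      (simp add: Poly_Mapping.lookup_sum lookup_single when_def in_keys_iff)
  ultimately have "f = (\<Sum>x \<in> Poly_Mapping.keys f. Poly_Mapping.single x (Poly_Mapping.lookup f x) -
      Poly_Mapping.single (?rep x) (Poly_Mapping.lookup f x))"
    by (simp add: sum_subtractf)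
  also have "\<dots> \<in> comm_ideal n"
    by (rule comm_ideal_sum) (auto intro: swap_comm_ideal rep split: nc_word.splits)
  finally show ?thesis .
qed

subsection \<open>Separation of irreducible words\<close>

text \<open>Collects coefficients of positions by letter, which turns solutions into the
  multiplicity functions of the uniqueness result.\<close>

fun weight_of :: "nat list \<Rightarrow> letter list \<Rightarrow> letter \<Rightarrow> nat" where
  "weight_of (l # ls) (b # w) a = (if a = b then l else 0) + weight_of ls w a"
| "weight_of _ _ a = 0"

lemma weight_of_pos_iff:
  "length ls = length w \<Longrightarrow> 0 \<notin> set ls \<Longrightarrow> 0 < weight_of ls w a \<longleftrightarrow> a \<in> set w"
  by (induction ls w rule: list_induct2) auto

lemma weight_vec_weight_of:
  "length ls = length w \<Longrightarrow> set w \<subseteq> letters n \<Longrightarrow>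
    weight_vec n (weight_of ls w) k = weighted_sum ls w k"
proof (induction ls w rule: list_induct2)
  case (Cons l ls b w)
  have "int (weight_of (l # ls) (b # w) a) * root_vec a k =
      (if a = b then int l * root_vec a k else 0) + int (weight_of ls w a) * root_vec a k" for a
    by (simp add: distrib_right)
  then show ?case using Cons by (simp add: weight_vec_def sum.distrib)
qed (simp add: weight_vec_def)

lemma common_solution_swap:
  assumes w: "good n w" "pairwise (compatible n) (set w)" "ls \<in> solutions w p"
    and w': "good n w'" "pairwise (compatible n) (set w')" "ls' \<in> solutions w' p"
  shows "(swap n)\<^sup>*\<^sup>* w w'"
proof -
  have pos: "0 < weight_of ls w a \<longleftrightarrow> a \<in> set w" "0 < weight_of ls' w' a \<longleftrightarrow> a \<in> set w'" for a
    using w(3) w'(3) by (auto simp: solutions_def weight_of_pos_iff)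
  have "weight_of ls w = weight_of ls' w'"
  proof (rule compatible_weight_unique)
    show "compatible_weight n (weight_of ls w)" "compatible_weight n (weight_of ls' w')"
      using w w' by (simp_all add: compatible_weight_def pos good_def)
    show "weight_vec n (weight_of ls w) = weight_vec n (weight_of ls' w')"
      using w w' by (intro ext) (simp add: weight_vec_weight_of solutions_def good_def)
  qed
  then have "set w = set w'" using pos by auto
  then show ?thesis using good_same_set w(1) w'(1) by blast
qed

text \<open>For each class, a vector is chosen at which exactly the compatible good words of that
  class have nonzero value, all the same; the class sum is then zero.\<close>

lemma comm_ideal_if_values_zero:
  assumes good: "good_poly n f"
    and compat: "\<And>w. coeff_of f w \<noteq> 0 \<Longrightarrow> pairwise (compatible n) (set w)"
    and zero: "\<And>p. linear_ext (word_value p) f = 0"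
  shows "f \<in> comm_ideal n"
proof (rule class_sums_zero_comm_ideal)
  fix w
  let ?K = "{x \<in> Poly_Mapping.keys f. \<exists>w'. x = Word w' \<and> (swap n)\<^sup>*\<^sup>* w w'}"
  show "(\<Sum>x \<in> ?K. Poly_Mapping.lookup f x) = 0"
  proof (cases "?K = {}")
    case False
    then obtain w1 where w1: "Word w1 \<in> Poly_Mapping.keys f" "(swap n)\<^sup>*\<^sup>* w w1" by auto
    have key: "good n v \<and> pairwise (compatible n) (set v)" if "Word v \<in> Poly_Mapping.keys f" for v
      using that good compat by (auto simp: good_poly_def coeff_of_def in_keys_iff)
    \<comment> \<open>The sum of the letters of \<open>w1\<close>: all coefficients 1 form a
      solution, so \<open>w1\<close> has nonzero value.\<close>
    define p where "p = weighted_sum (replicate (length w1) 1) w1"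
    have sol: "replicate (length w1) 1 \<in> solutions w1 p" by (auto simp: solutions_def p_def)
    have "finite (solutions w1 p)" using key[OF w1(1)] by (intro finite_solutions) (auto simp: good_def)
    then have "card (solutions w1 p) \<noteq> 0" using sol by auto
    then have nz: "word_value p w1 \<noteq> 0" by (simp add: word_value_def monom_eq_0_iff)
    have "linear_ext (word_value p) f = (\<Sum>x \<in> ?K. Poly_Mapping.lookup f x * word_value p w1)"
      unfolding linear_ext_def
    proof (rule sum.mono_neutral_cong_right, goal_cases)
      case 3
      show ?case
      proof
        fix x assume x: "x \<in> Poly_Mapping.keys f - ?K"
        obtain v where v: "x = Word v" by (cases x)
        have "solutions v p = {}"
        proof (rule ccontr)
          assume "solutions v p \<noteq> {}"
          then obtain ls where "ls \<in> solutions v p" by auto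
          then have "(swap n)\<^sup>*\<^sup>* w1 v"
            using common_solution_swap[OF _ _ sol] key[OF w1(1)] key[of v] x v by auto
          with w1(2) have "(swap n)\<^sup>*\<^sup>* w v" by (rule rtranclp_trans)
          then show False using x v by auto
        qed
        then show "Poly_Mapping.lookup f x * (case x of Word w \<Rightarrow> word_value p w) = 0"
          by (simp add: v word_value_def)
      qed
    next
      case (4 x)
      then obtain v where v: "x = Word v" "(swap n)\<^sup>*\<^sup>* w v" by auto
      have "(swap n)\<^sup>*\<^sup>* w1 v" using swap_rtranclp_sym[OF w1(2)] v(2) by (rule rtranclp_trans)
      then have "word_value p w1 = word_value p v"
        using key[OF w1(1)] by (intro word_value_swap_rtranclp) auto
      then show ?case by (simp add: v)
    qed auto
    then have "(\<Sum>x \<in> ?K. Poly_Mapping.lookup f x) * word_value p w1 = 0"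
      using zero by (simp only: sum_distrib_right)
    then show ?thesis using nz by simp
  qed (simp only: sum.empty)
qed

section \<open>Reduced forms of \<open>w_D\<close>\<close>

lemma reduced_form_properties:
  assumes "n \<ge> 2" "reduced_form n (w_D n) P"
  shows "good_poly n P" "linear_ext (word_value p) P = word_value p (w_D n)"
    "coeff_of P w \<noteq> 0 \<Longrightarrow> pairwise (compatible n) (set w)"
proof -
  have steps: "(step n)\<^sup>*\<^sup>* (mon (w_D n)) P" and irr: "irreducible_poly n P"
    using assms(2) by (auto simp: reduced_form_def)
  have "good_poly n (mon (w_D n))"
    using good_w_D[OF assms(1)] by (auto simp: mon_def intro: good_poly_single)
  from steps_invariant[OF steps this]
  show good: "good_poly n P" and "linear_ext (word_value p) P = word_value p (w_D n)"
    by (auto simp: mon_def linear_ext_single)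
  assume w: "coeff_of P w \<noteq> 0"
  then have "good n w" using good by (auto simp: good_poly_def)
  then show "pairwise (compatible n) (set w)"
    by (rule irreducible_compatible) (use irr w in \<open>auto simp: irreducible_poly_def\<close>)
qed

theorem mainTheorem19:
  fixes n :: nat and P Q :: ncpoly
  assumes "n \<ge> 2"
    and "reduced_form n (w_D n) P"
    and "reduced_form n (w_D n) Q"
  shows "eq_mod_comm n P Q"
proof -
  note P = reduced_form_properties[OF assms(1,2)] and Q = reduced_form_properties[OF assms(1,3)]
  have "P - Q \<in> comm_ideal n"
  proof (rule comm_ideal_if_values_zero)
    show "good_poly n (P - Q)" using good_poly_diff P(1) Q(1) .
    show "linear_ext (word_value p) (P - Q) = 0" for p
      by (simp add: linear_ext_diff P(2) Q(2))
    fix w assume "coeff_of (P - Q) w \<noteq> 0"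
    then have "coeff_of P w \<noteq> 0 \<or> coeff_of Q w \<noteq> 0"
      by (auto simp: coeff_of_def lookup_minus)
    then show "pairwise (compatible n) (set w)" using P(3) Q(3) by blast
  qed
  then show ?thesis by (simp add: eq_mod_comm_def)
qed

end
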